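(* Let $n\in\mathbb N_0$, $x\in\mathbb C$, let $\alpha\in\mathbb C$ with $-\alpha\notin\mathbb N_0$, and let $c,d\in\mathbb C\setminus\{0,1\}$. Then $$M_{n}(x;\alpha,c)=\frac{1}{(\alpha)_n}\sum_{k=0}^n \binom{n}{k}\frac{(\alpha)_k\,(x)_{n-k}}{d^{\,n-k}}\;{}_2F_1\!\left(\begin{matrix}-n+k,\,-x\\ -x+k-n+1\end{matrix};\frac{d}{c}\right) M_k(x;\alpha,d).$$
   Context: $\mathbb N_0=\{0,1,2,\dots\}$. Pochhammer symbol: $(a)_n=a(a+1)\cdots(a+n-1)$, $(a)_0=1$. Generalized hypergeometric series: ${}_rF_s\!\left(\begin{matrix}a_1,\dots,a_r\\ b_1,\dots,b_s\end{matrix};z\right)=\sum_{k\ge0}\frac{(a_1)_k\cdots(a_r)_k}{(b_1)_k\cdots(b_s)_k}\frac{z^k}{k!}$. The ${}_2F_1$ in the claim has the numerator parameter $-(n-k)$, so it is the finite sum over indices $0,\dots,n-k$. Meixner polynomials: $M_n(x;\alpha,c)={}_2F_1\!\left(\begin{matrix}-n,\,-x\\ \alpha\end{matrix};1-\frac1c\right)$ (a finite sum, for $-\alpha\notin\mathbb N_0$, $c\neq0$). Each product $(x)_{n-k}\,{}_2F_1(\cdots)$ is a polynomial in $x$ after cancellation of common factors; at values of $x$ for which a denominator Pochhammer symbol in the ${}_2F_1$ vanishes, the product denotes the value of that polynomial. *)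

theory Defs
  imports "HOL-Analysis.Analysis"
begin

definition hypergeo :: "complex list \<Rightarrow> complex list \<Rightarrow> complex \<Rightarrow> complex" where
  "hypergeo as bs z = eval_fps (fps_hypergeo as bs 1) z"

definition meixner :: "nat \<Rightarrow> complex \<Rightarrow> complex \<Rightarrow> complex \<Rightarrow> complex" where
  "meixner n x \<alpha> c = hypergeo [- of_nat n, - x] [\<alpha>] (1 - 1 / c)"

text \<open>
  The product of \<open>pochhammer y m\<close> and the terminating series
  \<open>hypergeo [- m, - y] [- y - m + 1] z\<close>, as a polynomial in \<open>y\<close>. The two agree wherever no
  denominator \<open>pochhammer (- y - m + 1) j\<close> with \<open>j \<le> m\<close> vanishes, which excludes
  finitely many \<open>y\<close> and so determines the polynomial (lemma \<open>ex1_poch_hypergeo_poly\<close>). At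
  the excluded points the product itself is meaningless, as HOL reads \<open>t / 0\<close> as \<open>0\<close>.
\<close>

definition is_poch_hypergeo_poly :: "nat \<Rightarrow> complex \<Rightarrow> complex poly \<Rightarrow> bool" where
  "is_poch_hypergeo_poly m z p \<longleftrightarrow>
     (\<forall>y. (\<forall>j\<le>m. pochhammer (- y - of_nat m + 1) j \<noteq> 0) \<longrightarrow>
        poly p y = pochhammer y m * hypergeo [- of_nat m, - y] [- y - of_nat m + 1] z)"

definition poch_hypergeo_poly :: "nat \<Rightarrow> complex \<Rightarrow> complex poly" where
  "poch_hypergeo_poly m z = (THE p. is_poch_hypergeo_poly m z p)"

lemma hypergeo_2_1_terminating:
  "hypergeo [- of_nat m, a] [b] z =
     (\<Sum>j\<le>m. pochhammer (- of_nat m) j * pochhammer a j / pochhammer b j * z ^ j / fact j)"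
proof -
  have "hypergeo [- of_nat m, a] [b] z =
      (\<Sum>j. pochhammer (- of_nat m) j * pochhammer a j / (pochhammer b j * fact j) * z ^ j)"
    by (simp add: hypergeo_def eval_fps_def)
  also have "\<dots> =
      (\<Sum>j\<le>m. pochhammer (- of_nat m) j * pochhammer a j / (pochhammer b j * fact j) * z ^ j)"
    by (rule suminf_finite) (auto simp: pochhammer_of_nat_eq_0_lemma)
  finally show ?thesis by simp
qed

lemma poly_pochhammer: "poly (pochhammer q n) x = pochhammer (poly q x) n"
  for q :: "complex poly"
  by (induction n) (simp_all add: pochhammer_Suc)

lemma poch_hypergeo_term:
  fixes y z :: complex
  assumes "j \<le> m" and nz: "pochhammer (- y - of_nat m + 1) j \<noteq> 0"
  shows "pochhammer y m * (pochhammer (- of_nat m) j * pochhammer (- y) j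
           / pochhammer (- y - of_nat m + 1) j * z ^ j / fact j)
         = of_nat (m choose j) * z ^ j * pochhammer (- y) j * pochhammer y (m - j)"
proof -
  have b: "pochhammer (- y - of_nat m + 1) j = (- 1) ^ j * pochhammer (y + of_nat (m - j)) j"
    using pochhammer_minus[of "y + of_nat m - 1" j] \<open>j \<le> m\<close>
    by (simp add: algebra_simps of_nat_diff)
  have m: "pochhammer (- of_nat m :: complex) j = (- 1) ^ j * (of_nat (m choose j) * fact j)"
    by (simp add: binomial_gbinomial gbinomial_pochhammer)
  have s: "pochhammer y m = pochhammer y (m - j) * pochhammer (y + of_nat (m - j)) j"
    using pochhammer_product'[of y "m - j" j] \<open>j \<le> m\<close> by simp
  have "pochhammer (y + of_nat (m - j)) j \<noteq> 0"
    using nz b by simp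
  then show ?thesis
    unfolding b m s by (simp add: field_simps)
qed

lemma is_poch_hypergeo_poly_explicit:
  "is_poch_hypergeo_poly m z
     (\<Sum>j\<le>m. smult (of_nat (m choose j) * z ^ j)
        (pochhammer (- [:0, 1:]) j * pochhammer [:0, 1:] (m - j)))"
  unfolding is_poch_hypergeo_poly_def hypergeo_2_1_terminating sum_distrib_left poly_sum
proof (intro allI impI sum.cong refl)
  fix y :: complex and j :: nat
  assume "\<forall>j\<le>m. pochhammer (- y - of_nat m + 1) j \<noteq> 0" "j \<in> {..m}"
  then show "poly (smult (of_nat (m choose j) * z ^ j)
        (pochhammer (- [:0, 1:]) j * pochhammer [:0, 1:] (m - j))) y =
      pochhammer y m * (pochhammer (- of_nat m) j * pochhammer (- y) j
        / pochhammer (- y - of_nat m + 1) j * z ^ j / fact j)"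
    by (subst poch_hypergeo_term) (simp_all add: poly_pochhammer mult.assoc)
qed

lemma ex1_poch_hypergeo_poly: "\<exists>!p. is_poch_hypergeo_poly m z p"
proof (rule ex_ex1I)
  show "\<exists>p. is_poch_hypergeo_poly m z p"
    using is_poch_hypergeo_poly_explicit by blast
next
  fix p q
  assume pq: "is_poch_hypergeo_poly m z p" "is_poch_hypergeo_poly m z q"
  define Y where "Y = (\<lambda>i. of_nat i - of_nat m + 1 :: complex) ` {..<m}"
  have "poly p y = poly q y" if "y \<notin> Y" for y
  proof -
    have "pochhammer (- y - of_nat m + 1) j \<noteq> 0" if "j \<le> m" for j
    proof
      assume "pochhammer (- y - of_nat m + 1) j = 0"
      then obtain i where "i < j" "- y - of_nat m + 1 = - of_nat i"
        by (auto simp: pochhammer_eq_0_iff)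
      then have "y = of_nat i - of_nat m + 1" "i < m"
        using \<open>j \<le> m\<close> by (auto simp: algebra_simps)
      then show False using \<open>y \<notin> Y\<close> by (auto simp: Y_def)
    qed
    then show ?thesis using pq by (simp add: is_poch_hypergeo_poly_def)
  qed
  then have "- Y \<subseteq> {y. poly (p - q) y = 0}" by auto
  moreover have "infinite (- Y)"
    by (rule ccontr) (use finite_Un[of Y "- Y"] infinite_UNIV_char_0[where 'a = complex] in \<open>auto simp: Y_def\<close>)
  ultimately have "infinite {y. poly (p - q) y = 0}" using finite_subset by blast
  then show "p = q" using poly_roots_finite[of "p - q"] by auto
qed

lemma poly_poch_hypergeo_poly:
  assumes "\<And>j. j \<le> m \<Longrightarrow> pochhammer (- y - of_nat m + 1) j \<noteq> 0"
  shows "poly (poch_hypergeo_poly m z) y =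
           pochhammer y m * hypergeo [- of_nat m, - y] [- y - of_nat m + 1] z"
  using theI'[OF ex1_poch_hypergeo_poly[of m z]] assms
  by (simp add: poch_hypergeo_poly_def is_poch_hypergeo_poly_def)

lemma poly_poch_hypergeo_poly_explicit:
  "poly (poch_hypergeo_poly m z) y =
     (\<Sum>j\<le>m. of_nat (m choose j) * z ^ j * pochhammer (- y) j * pochhammer y (m - j))"
  unfolding poch_hypergeo_poly_def
    the1_equality[OF ex1_poch_hypergeo_poly is_poch_hypergeo_poly_explicit]
  by (simp add: poly_sum poly_pochhammer mult.assoc)

end

theory Submission
  imports Defs
begin

text \<open>
  Write \<open>(1 - z t) powr (- a)\<close> for the formal power series \<open>\<Sum>n. pochhammer a n / n! * (z t)^n\<close>. For
  \<open>- \<alpha> \<notin> \<nat>\<close> the Meixner polynomials have the generating function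
  \<open>(\<Sum>n. pochhammer \<alpha> n / n! * M\<^sub>n(x; \<alpha>, c) * t^n) = (1 - t/c) powr x * (1 - t) powr (- x - \<alpha>)\<close>
  (lemma \<open>fps_meixner\<close>). Changing \<open>d\<close> into \<open>c\<close> therefore multiplies it by
  \<open>(1 - t/c) powr x * (1 - t/d) powr (- x)\<close>, independently of \<open>\<alpha>\<close>. The coefficients of this factor
  are the terminating series \<open>poch_hypergeo_poly\<close> at \<open>d/c\<close>, up to \<open>m! * d^m\<close>
  (lemma \<open>fps_connection_factor\<close>). Comparing coefficients of \<open>t^n\<close> gives the theorem.

  The generating function itself rests on the Chu--Vandermonde identity: after
  expanding \<open>(1 - 1/c)^j\<close> in powers of \<open>1/c\<close>, the coefficient of each power is a Vandermonde sum.
\<close>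

text \<open>
  The series \<open>(1 - z t) powr (- a)\<close>, with rising factorials instead of \<open>(- a) gchoose n\<close> so that
  its coefficients match hypergeometric terms without signs.
\<close>

definition fps_neg_binomial :: "complex \<Rightarrow> complex \<Rightarrow> complex fps" where
  "fps_neg_binomial a z = Abs_fps (\<lambda>n. pochhammer a n / fact n * z ^ n)"

lemma fps_neg_binomial_nth [simp]:
  "fps_nth (fps_neg_binomial a z) n = pochhammer a n / fact n * z ^ n"
  by (simp add: fps_neg_binomial_def)

lemma fps_neg_binomial_0 [simp]: "fps_neg_binomial 0 z = 1"
  by (rule fps_ext) (auto simp: pochhammer_0_left)

lemma fps_neg_binomial_mult_nth:
  "fps_nth (fps_neg_binomial a y * fps_neg_binomial b z) n =
     (\<Sum>j\<le>n. of_nat (n choose j) * pochhammer a j * y ^ j * pochhammer b (n - j) * z ^ (n - j))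
       / fact n"
  unfolding fps_mult_nth sum_divide_distrib atLeast0AtMost
  by (intro sum.cong refl) (simp add: binomial_fact field_simps)

lemma fps_neg_binomial_add:
  "fps_neg_binomial (a + b) z = fps_neg_binomial a z * fps_neg_binomial b z"
proof (rule fps_ext)
  fix n
  have "(\<Sum>j\<le>n. of_nat (n choose j) * pochhammer a j * z ^ j * pochhammer b (n - j) * z ^ (n - j))
      = pochhammer (a + b) n * z ^ n"
    unfolding pochhammer_binomial_sum sum_distrib_right
    by (intro sum.cong refl) (simp add: mult_ac flip: power_add)
  then show "fps_nth (fps_neg_binomial (a + b) z) n =
      fps_nth (fps_neg_binomial a z * fps_neg_binomial b z) n"
    unfolding fps_neg_binomial_mult_nth by simp
qed

text \<open>
  Chu--Vandermonde for a difference of parameters: reflecting \<open>pochhammer (b + l) (m - l)\<close> at its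
  upper end \<open>b + m - 1\<close>, which does not depend on \<open>l\<close>, turns the alternating sum into the
  ordinary binomial theorem for rising factorials.
\<close>

lemma pochhammer_diff_binomial_sum:
  fixes a b :: complex
  shows "(\<Sum>l\<le>m. of_nat (m choose l) * (- 1) ^ l * pochhammer a l * pochhammer (b + of_nat l) (m - l))
    = pochhammer (b - a) m"
proof -
  have reflect: "pochhammer (b + of_nat l) (m - l)
      = (- 1) ^ (m - l) * pochhammer (1 - b - of_nat m) (m - l)" if "l \<le> m" for l
    using pochhammer_minus[of "b + of_nat m - 1" "m - l"] that
    by (simp add: of_nat_diff algebra_simps flip: power_mult_distrib)
  have sign: "(- 1 :: complex) ^ l * (- 1) ^ (m - l) = (- 1) ^ m" if "l \<le> m" for l
    using that by (simp flip: power_add)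
  have "(\<Sum>l\<le>m. of_nat (m choose l) * (- 1) ^ l * pochhammer a l * pochhammer (b + of_nat l) (m - l))
      = (\<Sum>l\<le>m. ((- 1) ^ l * (- 1) ^ (m - l))
           * (of_nat (m choose l) * pochhammer a l * pochhammer (1 - b - of_nat m) (m - l)))"
    by (intro sum.cong) (simp_all add: reflect)
  also have "\<dots> = (- 1) ^ m * pochhammer (a + (1 - b - of_nat m)) m"
    unfolding pochhammer_binomial_sum sum_distrib_left
    by (intro sum.cong) (simp_all add: sign)
  also have "\<dots> = pochhammer (b - a) m"
    using pochhammer_minus[of "b - a + of_nat m - 1" m]
    by (simp add: algebra_simps flip: power_mult_distrib)
  finally show ?thesis .
qed

text \<open>
  The transformation of a terminating series in \<open>1 - z\<close> into one in \<open>z\<close>: both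
  sides are polynomials in \<open>z\<close>, and the coefficient of \<open>z ^ i\<close> on the left is the previous sum
  with the parameters shifted by \<open>i\<close>.
\<close>

lemma pochhammer_sum_one_minus:
  fixes a b z :: complex
  shows "(\<Sum>j\<le>n. of_nat (n choose j) * (- 1) ^ j * pochhammer a j * pochhammer (b + of_nat j) (n - j)
           * (1 - z) ^ j)
    = (\<Sum>i\<le>n. of_nat (n choose i) * pochhammer a i * z ^ i * pochhammer (b - a) (n - i))"
proof -
  define T where "T j i = of_nat (n choose j) * of_nat (j choose i) * (- 1) ^ (j + i) * pochhammer a j
      * pochhammer (b + of_nat j) (n - j) * z ^ i" for j i
  have "(\<Sum>j\<le>n. of_nat (n choose j) * (- 1) ^ j * pochhammer a j * pochhammer (b + of_nat j) (n - j)
           * (1 - z) ^ j) = (\<Sum>j\<le>n. \<Sum>i\<le>j. T j i)"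
  proof (intro sum.cong refl)
    fix j
    have "(1 - z) ^ j = (\<Sum>i\<le>j. of_nat (j choose i) * ((- 1) ^ i * z ^ i))"
      using binomial_ring[of "- z" 1 j] by (simp add: power_minus[of z])
    then show "of_nat (n choose j) * (- 1) ^ j * pochhammer a j * pochhammer (b + of_nat j) (n - j)
        * (1 - z) ^ j = (\<Sum>i\<le>j. T j i)"
      by (simp add: sum_distrib_left T_def power_add mult_ac)
  qed
  also have "\<dots> = (\<Sum>i\<le>n. \<Sum>j=i..n. T j i)"
    unfolding sum.Sigma[OF finite_atMost ballI[OF finite_atMost]]
      sum.Sigma[OF finite_atMost ballI[OF finite_atLeastAtMost]]
    by (rule sum.reindex_bij_witness[of _ prod.swap prod.swap]) auto
  also have "\<dots> = (\<Sum>i\<le>n. of_nat (n choose i) * pochhammer a i * z ^ i * pochhammer (b - a) (n - i))"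
  proof (intro sum.cong refl)
    fix i assume "i \<in> {..n}"
    then have i: "i \<le> n" by simp
    have "(\<Sum>j=i..n. T j i) = (\<Sum>l\<le>n - i. T (l + i) i)"
      using sum.shift_bounds_cl_nat_ivl[of "\<lambda>j. T j i" 0 i "n - i"] i by (simp add: atLeast0AtMost)
    also have "\<dots> = of_nat (n choose i) * pochhammer a i * z ^ i *
        (\<Sum>l\<le>n - i. of_nat ((n - i) choose l) * (- 1) ^ l * pochhammer (a + of_nat i) l
           * pochhammer (b + of_nat i + of_nat l) (n - i - l))"
      unfolding sum_distrib_left
    proof (intro sum.cong refl)
      fix l assume "l \<in> {..n - i}"
      then have "(n choose (l + i)) * ((l + i) choose i) = (n choose i) * ((n - i) choose l)"
        using choose_mult[of i "l + i" n] i by simp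
      then have ch: "of_nat (n choose (l + i)) * of_nat ((l + i) choose i)
          = (of_nat (n choose i) * of_nat ((n - i) choose l) :: complex)"
        by (metis of_nat_mult)
      show "T (l + i) i = of_nat (n choose i) * pochhammer a i * z ^ i *
        (of_nat ((n - i) choose l) * (- 1) ^ l * pochhammer (a + of_nat i) l
           * pochhammer (b + of_nat i + of_nat l) (n - i - l))"
        unfolding T_def ch using pochhammer_product'[of a i l]
        by (simp add: power_add add_ac mult_ac diff_diff_eq)
    qed
    also have "\<dots> = of_nat (n choose i) * pochhammer a i * z ^ i * pochhammer (b - a) (n - i)"
      unfolding pochhammer_diff_binomial_sum by simp
    finally show "(\<Sum>j=i..n. T j i)
        = of_nat (n choose i) * pochhammer a i * z ^ i * pochhammer (b - a) (n - i)" .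
  qed
  finally show ?thesis .
qed

text \<open>
  Multiplication by \<open>pochhammer \<alpha> n\<close> absorbs the denominators \<open>pochhammer \<alpha> j\<close> and leaves the left
  side of the transformation above, with \<open>z = 1 / c\<close>.
\<close>

lemma pochhammer_mult_meixner:
  assumes "- \<alpha> \<notin> \<nat>"
  shows "pochhammer \<alpha> n * meixner n x \<alpha> c =
    (\<Sum>j\<le>n. of_nat (n choose j) * (- 1) ^ j * pochhammer (- x) j * pochhammer (\<alpha> + of_nat j) (n - j)
       * (1 - 1 / c) ^ j)"
  unfolding meixner_def hypergeo_2_1_terminating sum_distrib_left
proof (intro sum.cong refl)
  fix j assume "j \<in> {..n}"
  then have j: "pochhammer \<alpha> n = pochhammer \<alpha> j * pochhammer (\<alpha> + of_nat j) (n - j)"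
    by (intro pochhammer_product) simp
  have nz: "pochhammer \<alpha> j \<noteq> 0"
    using assms by (metis of_nat_in_Nats minus_minus pochhammer_eq_0_iff)
  have m: "pochhammer (- of_nat n :: complex) j = (- 1) ^ j * (of_nat (n choose j) * fact j)"
    by (simp add: binomial_gbinomial gbinomial_pochhammer)
  show "pochhammer \<alpha> n * (pochhammer (- of_nat n) j * pochhammer (- x) j / pochhammer \<alpha> j
      * (1 - 1 / c) ^ j / fact j)
    = of_nat (n choose j) * (- 1) ^ j * pochhammer (- x) j * pochhammer (\<alpha> + of_nat j) (n - j)
       * (1 - 1 / c) ^ j"
    unfolding j m using nz by simp
qed

lemma fps_meixner:
  assumes "- \<alpha> \<notin> \<nat>"
  shows "Abs_fps (\<lambda>n. pochhammer \<alpha> n / fact n * meixner n x \<alpha> c)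
    = fps_neg_binomial (- x) (1 / c) * fps_neg_binomial (x + \<alpha>) 1"
proof (rule fps_ext)
  fix n
  show "fps_nth (Abs_fps (\<lambda>n. pochhammer \<alpha> n / fact n * meixner n x \<alpha> c)) n
      = fps_nth (fps_neg_binomial (- x) (1 / c) * fps_neg_binomial (x + \<alpha>) 1) n"
    using pochhammer_mult_meixner[OF assms, of n x c]
      pochhammer_sum_one_minus[of n "- x" \<alpha> "1 / c"]
    by (simp add: fps_neg_binomial_mult_nth add.commute)
qed

lemma fps_connection_factor:
  assumes "d \<noteq> 0"
  shows "Abs_fps (\<lambda>m. poly (poch_hypergeo_poly m (d / c)) x / (d ^ m * fact m))
    = fps_neg_binomial (- x) (1 / c) * fps_neg_binomial x (1 / d)"
proof (rule fps_ext)
  fix m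
  have weight: "(d / c) ^ j / d ^ m = (1 / c) ^ j * (1 / d) ^ (m - j)" if "j \<le> m" for j
    using assms that by (simp add: power_diff field_simps)
  then have "poly (poch_hypergeo_poly m (d / c)) x / d ^ m = (\<Sum>j\<le>m. of_nat (m choose j)
      * pochhammer (- x) j * (1 / c) ^ j * pochhammer x (m - j) * (1 / d) ^ (m - j))"
    unfolding poly_poch_hypergeo_poly_explicit sum_divide_distrib
  proof (intro sum.cong refl)
    fix j assume "j \<in> {..m}"
    then have "of_nat (m choose j) * pochhammer (- x) j * pochhammer x (m - j) * ((d / c) ^ j / d ^ m)
        = of_nat (m choose j) * pochhammer (- x) j * pochhammer x (m - j)
            * ((1 / c) ^ j * (1 / d) ^ (m - j))"
      by (simp only: weight atMost_iff)
    then show "of_nat (m choose j) * (d / c) ^ j * pochhammer (- x) j * pochhammer x (m - j) / d ^ m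
        = of_nat (m choose j) * pochhammer (- x) j * (1 / c) ^ j * pochhammer x (m - j)
            * (1 / d) ^ (m - j)"
      by (simp add: mult_ac)
  qed
  then show "fps_nth (Abs_fps (\<lambda>m. poly (poch_hypergeo_poly m (d / c)) x / (d ^ m * fact m))) m
      = fps_nth (fps_neg_binomial (- x) (1 / c) * fps_neg_binomial x (1 / d)) m"
    by (simp add: fps_neg_binomial_mult_nth flip: divide_divide_eq_left)
qed

theorem theorem4:
  fixes n :: nat and x \<alpha> c d :: complex
  assumes "- \<alpha> \<notin> \<nat>"
    and "c \<notin> {0, 1}" and "d \<notin> {0, 1}"
  shows "meixner n x \<alpha> c =
    1 / pochhammer \<alpha> n *
      (\<Sum>k=0..n. of_nat (n choose k) * (pochhammer \<alpha> k / d ^ (n - k))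
         * poly (poch_hypergeo_poly (n - k) (d / c)) x * meixner k x \<alpha> d)"
proof -
  define G where "G e = Abs_fps (\<lambda>n. pochhammer \<alpha> n / fact n * meixner n x \<alpha> e)" for e
  define Q where "Q = Abs_fps (\<lambda>m. poly (poch_hypergeo_poly m (d / c)) x / (d ^ m * fact m))"
  have "d \<noteq> 0" using assms(3) by simp
  have "fps_neg_binomial x (1 / d) * fps_neg_binomial (- x) (1 / d) = 1"
    by (simp flip: fps_neg_binomial_add)
  then have "G c = G d * Q"
    unfolding G_def Q_def fps_meixner[OF assms(1)] fps_connection_factor[OF \<open>d \<noteq> 0\<close>]
    by (simp add: mult_ac)
  then have "fps_nth (G c) n = fps_nth (G d * Q) n"
    by simp
  then have "pochhammer \<alpha> n / fact n * meixner n x \<alpha> c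
      = (\<Sum>k=0..n. pochhammer \<alpha> k / fact k * meixner k x \<alpha> d
          * (poly (poch_hypergeo_poly (n - k) (d / c)) x / (d ^ (n - k) * fact (n - k))))"
    by (simp add: G_def Q_def fps_mult_nth)
  then have "pochhammer \<alpha> n * meixner n x \<alpha> c
      = fact n * (\<Sum>k=0..n. pochhammer \<alpha> k / fact k * meixner k x \<alpha> d
          * (poly (poch_hypergeo_poly (n - k) (d / c)) x / (d ^ (n - k) * fact (n - k))))"
    by (simp add: field_simps)
  also have "\<dots> = (\<Sum>k=0..n. of_nat (n choose k) * (pochhammer \<alpha> k / d ^ (n - k))
         * poly (poch_hypergeo_poly (n - k) (d / c)) x * meixner k x \<alpha> d)"
    unfolding sum_distrib_left by (intro sum.cong refl) (simp add: binomial_fact mult_ac)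
  finally have "pochhammer \<alpha> n * meixner n x \<alpha> c = \<dots>" .
  moreover have "pochhammer \<alpha> n \<noteq> 0"
    using assms(1) by (metis of_nat_in_Nats minus_minus pochhammer_eq_0_iff)
  ultimately show ?thesis by (simp add: field_simps)
qed

end
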